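(* Let $I = [a,b] \subset \mathbb{R}$ and $J = \{(x,y) : x \in I,\ y \in [a,x]\} \subset I \times I$. Suppose $\varphi \in C(I, \mathbb{R}^n)$ and $K \in C(J \times \mathbb{R}^n, \mathbb{R}^n)$ and that $K$ is Lipschitz in the last variable: there exists $L \in \mathbb{R}$ such that $$|K(x,y,\mathbf{z}) - K(x,y,\mathbf{z}')|_{\mathrm{sum}} \leq L\,|\mathbf{z} - \mathbf{z}'|_{\mathrm{sum}}$$ for all $(x,y) \in J$ and all $\mathbf{z}, \mathbf{z}' \in \mathbb{R}^n$. Then for any choice of the initial mapping $\mathbf{y}^{[0]}(t)$ the sequence of Picard iterates $$\mathbf{y}^{[k+1]}(t) = \varphi(t) + \int_a^t K(t, s, \mathbf{y}^{[k]}(s))\, ds$$ converges to the unique solution of the integral equation $$\mathbf{y}(t) = \varphi(t) + \int_a^t K(t,s,\mathbf{y}(s))\, ds.$$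
   Context: For a subset $S$ of $\mathbb{R}^m$, $C(S,\mathbb{R}^n)$ denotes the set of continuous mappings from $S$ into $\mathbb{R}^n$. For $\mathbf{z} = (z_1,\dots,z_n) \in \mathbb{R}^n$, $|\mathbf{z}|_{\mathrm{sum}} = |z_1| + \cdots + |z_n|$. Integrals of vector-valued functions are taken componentwise. Under the stated hypotheses the integral equation has a unique solution $\mathbf{y}(t) \in C(I,\mathbb{R}^n)$; this is the unique solution referred to in the claim. *)

theory Defs
  imports "HOL-Analysis.Analysis"
begin

definition sum_norm :: "real ^ 'n \<Rightarrow> real"
  where "sum_norm z = (\<Sum>i\<in>UNIV. \<bar>z $ i\<bar>)"

definition volterra_domain :: "real \<Rightarrow> real \<Rightarrow> (real \<times> real) set"
  where "volterra_domain a b = {(x, y). x \<in> {a..b} \<and> y \<in> {a..x}}"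

(* The Henstock-Kurzweil integral of a vector-valued function agrees with the componentwise
   integral whenever the integrand is integrable; under the hypotheses of the theorem all
   integrands with continuous y are continuous on {a..t} for t in {a..b}.  Values at t outside
   {a..b} carry no meaning. *)
definition picard_op ::
    "real \<Rightarrow> (real \<Rightarrow> real ^ 'n) \<Rightarrow> (real \<Rightarrow> real \<Rightarrow> real ^ 'n \<Rightarrow> real ^ 'n)
      \<Rightarrow> (real \<Rightarrow> real ^ 'n) \<Rightarrow> real \<Rightarrow> real ^ 'n"
  where "picard_op a \<phi> K y t = \<phi> t + integral {a..t} (\<lambda>s. K t s (y s))"

primrec picard_iterate ::
    "real \<Rightarrow> (real \<Rightarrow> real ^ 'n) \<Rightarrow> (real \<Rightarrow> real \<Rightarrow> real ^ 'n \<Rightarrow> real ^ 'n)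
      \<Rightarrow> (real \<Rightarrow> real ^ 'n) \<Rightarrow> nat \<Rightarrow> real \<Rightarrow> real ^ 'n"
  where
    "picard_iterate a \<phi> K y0 0 = y0"
  | "picard_iterate a \<phi> K y0 (Suc k) = picard_op a \<phi> K (picard_iterate a \<phi> K y0 k)"

definition volterra_solution ::
    "real \<Rightarrow> real \<Rightarrow> (real \<Rightarrow> real ^ 'n) \<Rightarrow> (real \<Rightarrow> real \<Rightarrow> real ^ 'n \<Rightarrow> real ^ 'n)
      \<Rightarrow> (real \<Rightarrow> real ^ 'n) \<Rightarrow> bool"
  where "volterra_solution a b \<phi> K y \<longleftrightarrow>
    continuous_on {a..b} y \<and> (\<forall>t\<in>{a..b}. y t = picard_op a \<phi> K y t)"

end

theory Submission
  imports Defs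
begin

text \<open>
  Two sequences of Picard iterates whose starting points differ by at most \<open>C\<close> differ after
  \<open>k\<close> steps at \<open>t\<close> by at most \<open>C * (M * (t - a)) ^ k / fact k\<close>. Comparing a
  sequence with its own shift gives a uniform limit, which solves the equation; comparing an
  arbitrary sequence with the constant sequence of a solution gives both uniqueness and
  convergence from every starting point.
\<close>

section \<open>Comparison of the sum norm with the Euclidean norm\<close>

lemma norm_le_sum_norm: "norm z \<le> sum_norm z"
  unfolding sum_norm_def by (rule norm_le_l1_cart)

lemma sum_norm_le_card_norm: "sum_norm (z :: real ^ 'n) \<le> real CARD('n) * norm z"
  unfolding sum_norm_def
  using sum_bounded_above[of UNIV "\<lambda>i. \<bar>z $ i\<bar>" "norm z"] component_le_norm_cart by auto

lemma sum_norm_nonneg: "0 \<le> sum_norm z"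
  unfolding sum_norm_def by (simp add: sum_nonneg)

text \<open>The substitution \<open>s = a + (t - a) * r\<close> moves the dependence on
  \<open>t\<close> from the domain of integration into the integrand, so that continuity of
  parameter integrals over a fixed interval can be used. For \<open>a = t\<close> the scaling
  degenerates, but both sides vanish.\<close>

lemma integral_eq_unit_interval:
  fixes f :: "real \<Rightarrow> 'a :: euclidean_space"
  assumes "a \<le> t" "continuous_on {a..t} f"
  shows "integral {a..t} f = (t - a) *\<^sub>R integral {0..1} (\<lambda>r. f (a + (t - a) * r))"
proof (cases "a = t")
  case False
  with assms have "a < t" by simp
  have "(f has_integral integral {a..t} f) (cbox a t)"
    using integrable_continuous_interval[OF assms(2)] by (simp add: has_integral_integral)
  from has_integral_affinity'[OF this, of "t - a" a] \<open>a < t\<close>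
  have "((\<lambda>r. f (a + (t - a) * r)) has_integral integral {a..t} f /\<^sub>R (t - a)) {0..1}"
    by (simp add: add.commute)
  then have "integral {0..1} (\<lambda>r. f (a + (t - a) * r)) = integral {a..t} f /\<^sub>R (t - a)"
    by (rule integral_unique)
  then show ?thesis using \<open>a < t\<close> by simp
qed simp

text \<open>The Lipschitz condition is stated in the Euclidean norm, which is the norm behind
  integral estimates and \<open>dist\<close>. Equivalence of norms changes only the
  constant.\<close>

locale volterra_equation =
  fixes a b M :: real
    and \<phi> :: "real \<Rightarrow> real ^ 'n"
    and K :: "real \<Rightarrow> real \<Rightarrow> real ^ 'n \<Rightarrow> real ^ 'n"
  assumes interval: "a \<le> b"
    and forcing_continuous: "continuous_on {a..b} \<phi>"
    and kernel_continuous: "continuous_on (volterra_domain a b \<times> UNIV) (\<lambda>((x, y), z). K x y z)"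
    and lipschitz_pos: "0 < M"
    and kernel_lipschitz:
      "(x, y) \<in> volterra_domain a b \<Longrightarrow> norm (K x y z - K x y z') \<le> M * norm (z - z')"
begin

section \<open>Continuity of the integrand and of the Picard operator\<close>

lemma continuous_on_kernel:
  assumes "continuous_on S p" "continuous_on S q" "continuous_on S r"
    and "\<And>x. x \<in> S \<Longrightarrow> (p x, q x) \<in> volterra_domain a b"
  shows "continuous_on S (\<lambda>x. K (p x) (q x) (r x))"
proof -
  have "continuous_on S ((\<lambda>((x, y), z). K x y z) \<circ> (\<lambda>x. ((p x, q x), r x)))"
    by (rule continuous_on_compose)
      (use assms in \<open>auto intro!: continuous_intros continuous_on_subset[OF kernel_continuous]\<close>)
  then show ?thesis by (simp add: o_def)
qed

lemma continuous_on_integrand: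
  assumes "t \<in> {a..b}" "continuous_on {a..b} u"
  shows "continuous_on {a..t} (\<lambda>s. K t s (u s))"
  by (rule continuous_on_kernel)
    (use assms in \<open>auto intro!: continuous_intros intro: continuous_on_subset simp: volterra_domain_def\<close>)

text \<open>After rescaling to the unit interval the integrand is jointly continuous in
  \<open>(t, r)\<close>: the point \<open>a + (t - a) * r\<close> stays in \<open>{a..t}\<close>, so
  the kernel is evaluated only on the triangle where it is known to be continuous.\<close>

lemma continuous_on_picard_op:
  assumes u: "continuous_on {a..b} u"
  shows "continuous_on {a..b} (picard_op a \<phi> K u)"
proof -
  have mem: "a + (t - a) * r \<in> {a..t}" if "t \<in> {a..b}" "r \<in> {0..1}" for t r
    using that mult_left_le[of r "t - a"] by auto
  have dom: "(t, a + (t - a) * r) \<in> volterra_domain a b" if "t \<in> {a..b}" "r \<in> {0..1}" for t r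
    using mem[OF that] that by (auto simp: volterra_domain_def)
  have "continuous_on ({a..b} \<times> {0..1})
      (\<lambda>x. K (fst x) (a + (fst x - a) * snd x) (u (a + (fst x - a) * snd x)))"
  proof (rule continuous_on_kernel)
    show "continuous_on ({a..b} \<times> {0..1}) (\<lambda>x. u (a + (fst x - a) * snd x))"
    proof (rule continuous_on_compose2[OF u])
      show "(\<lambda>x. a + (fst x - a) * snd x) ` ({a..b} \<times> {0..1}) \<subseteq> {a..b}"
        using mem by fastforce
    qed (intro continuous_intros)
  qed (use dom in \<open>auto intro!: continuous_intros\<close>)
  then have "continuous_on {a..b} (\<lambda>t. integral (cbox 0 1)
      (\<lambda>r. K t (a + (t - a) * r) (u (a + (t - a) * r))))"
    by (intro integral_continuous_on_param) (simp add: case_prod_unfold)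
  then have "continuous_on {a..b} (\<lambda>t. \<phi> t + (t - a) *\<^sub>R integral {0..1}
      (\<lambda>r. K t (a + (t - a) * r) (u (a + (t - a) * r))))"
    by (auto intro!: continuous_intros forcing_continuous)
  then show ?thesis
    by (rule continuous_on_eq)
      (simp add: picard_op_def integral_eq_unit_interval continuous_on_integrand u)
qed

lemma continuous_on_picard_iterate:
  assumes "continuous_on {a..b} y0"
  shows "continuous_on {a..b} (picard_iterate a \<phi> K y0 k)"
  by (induction k) (simp_all add: assms continuous_on_picard_op)

section \<open>Factorial decay of differences of Picard sequences\<close>

lemma picard_op_diff_le:
  assumes t: "t \<in> {a..b}"
    and u: "continuous_on {a..b} u" and v: "continuous_on {a..b} v"
    and le: "\<And>s. s \<in> {a..t} \<Longrightarrow> norm (u s - v s) \<le> g s"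
    and g: "(g has_integral G) {a..t}"
  shows "norm (picard_op a \<phi> K u t - picard_op a \<phi> K v t) \<le> M * G"
proof -
  have int: "(\<lambda>s. K t s (w s)) integrable_on {a..t}" if "continuous_on {a..b} w" for w
    using integrable_continuous_interval[OF continuous_on_integrand[OF t that]] .
  have Mg: "((\<lambda>s. M * g s) has_integral M * G) {a..t}"
    using has_integral_mult_right[OF g] .
  have "picard_op a \<phi> K u t - picard_op a \<phi> K v t
      = integral {a..t} (\<lambda>s. K t s (u s) - K t s (v s))"
    by (simp add: picard_op_def integral_diff int u v)
  also have "norm \<dots> \<le> integral {a..t} (\<lambda>s. M * g s)"
  proof (rule integral_norm_bound_integral)
    fix s assume s: "s \<in> {a..t}"
    then have "norm (K t s (u s) - K t s (v s)) \<le> M * norm (u s - v s)"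
      using t by (intro kernel_lipschitz) (auto simp: volterra_domain_def)
    also have "\<dots> \<le> M * g s"
      using le[OF s] lipschitz_pos by simp
    finally show "norm (K t s (u s) - K t s (v s)) \<le> M * g s" .
  qed (use Mg in \<open>auto intro!: integrable_diff int u v\<close>)
  also have "\<dots> = M * G"
    using Mg by (rule integral_unique)
  finally show ?thesis .
qed

text \<open>Each step integrates the previous bound and multiplies it by \<open>M\<close>, which
  adds a factor \<open>M * (t - a) / (k + 1)\<close>. The recursions are required on
  \<open>{a..b}\<close> only, so that the constant sequence of a solution qualifies.\<close>

lemma picard_sequences_diff_le:
  assumes u: "\<And>k. continuous_on {a..b} (u k)" and v: "\<And>k. continuous_on {a..b} (v k)"
    and u_step: "\<And>k t. t \<in> {a..b} \<Longrightarrow> u (Suc k) t = picard_op a \<phi> K (u k) t"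
    and v_step: "\<And>k t. t \<in> {a..b} \<Longrightarrow> v (Suc k) t = picard_op a \<phi> K (v k) t"
    and C: "\<And>t. t \<in> {a..b} \<Longrightarrow> norm (u 0 t - v 0 t) \<le> C"
    and t: "t \<in> {a..b}"
  shows "norm (u k t - v k t) \<le> C * (M * (t - a)) ^ k / fact k"
  using t
proof (induction k arbitrary: t)
  case (Suc k)
  \<comment> \<open>An antiderivative of the bound in the induction hypothesis, vanishing at
    \<open>a\<close>. It carries \<open>M ^ k\<close> only; the remaining factor \<open>M\<close>
    comes from the Lipschitz estimate in \<open>picard_op_diff_le\<close>.\<close>
  let ?F = "\<lambda>s. C * M ^ k / fact (Suc k) * (s - a) ^ Suc k"
  have "((\<lambda>s. C * (M * (s - a)) ^ k / fact k) has_integral ?F t - ?F a) {a..t}"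
  proof (rule fundamental_theorem_of_calculus)
    fix s
    have "(?F has_real_derivative C * M ^ k / fact (Suc k) * (real (Suc k) * (s - a) ^ k))
        (at s within {a..t})"
      by (rule derivative_eq_intros refl)+ (simp del: fact_Suc of_nat_Suc)
    moreover have "C * M ^ k / fact (Suc k) * (real (Suc k) * (s - a) ^ k)
        = C * (M * (s - a)) ^ k / fact k"
      by (simp add: power_mult_distrib divide_simps del: of_nat_Suc)
    ultimately show "(?F has_vector_derivative C * (M * (s - a)) ^ k / fact k) (at s within {a..t})"
      by (simp only: has_real_derivative_iff_has_vector_derivative)
  qed (use Suc.prems in simp)
  moreover have "norm (u k s - v k s) \<le> C * (M * (s - a)) ^ k / fact k" if "s \<in> {a..t}" for s
    using Suc.IH[of s] that Suc.prems by auto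
  ultimately have "norm (u (Suc k) t - v (Suc k) t) \<le> M * (?F t - ?F a)"
    unfolding u_step[OF Suc.prems] v_step[OF Suc.prems]
    by (intro picard_op_diff_le) (use Suc.prems u v in auto)
  also have "\<dots> = C * (M * (t - a)) ^ Suc k / fact (Suc k)"
    by (simp add: power_mult_distrib)
  finally show ?case .
qed (use C in simp)

lemma continuous_diff_bounded:
  fixes u v :: "real \<Rightarrow> real ^ 'n"
  assumes "continuous_on {a..b} u" "continuous_on {a..b} v"
  obtains C where "0 \<le> C" "\<And>t. t \<in> {a..b} \<Longrightarrow> norm (u t - v t) \<le> C"
proof -
  have "bounded ((\<lambda>t. u t - v t) ` {a..b})"
    by (intro compact_imp_bounded compact_continuous_image continuous_on_diff assms) simp
  then show ?thesis
    using that unfolding bounded_pos by (metis imageI less_imp_le)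
qed

text \<open>Replacing \<open>t - a\<close> by \<open>b - a\<close> makes the bound independent of
  \<open>t\<close>, as uniform convergence demands. The constant \<open>C\<close> bounds the initial
  difference, which is continuous on a compact interval.\<close>

lemma picard_sequences_diff_le_uniform:
  assumes "\<And>k. continuous_on {a..b} (u k)" "\<And>k. continuous_on {a..b} (v k)"
    and "\<And>k t. t \<in> {a..b} \<Longrightarrow> u (Suc k) t = picard_op a \<phi> K (u k) t"
    and "\<And>k t. t \<in> {a..b} \<Longrightarrow> v (Suc k) t = picard_op a \<phi> K (v k) t"
  obtains C where
    "\<And>k t. t \<in> {a..b} \<Longrightarrow> norm (u k t - v k t) \<le> C * ((M * (b - a)) ^ k / fact k)"
proof -
  obtain C where C: "0 \<le> C" "\<And>t. t \<in> {a..b} \<Longrightarrow> norm (u 0 t - v 0 t) \<le> C"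
    using continuous_diff_bounded[OF assms(1)[of 0] assms(2)[of 0]] by blast
  show ?thesis
  proof (rule that)
    fix k t assume t: "t \<in> {a..b}"
    have "norm (u k t - v k t) \<le> C * (M * (t - a)) ^ k / fact k"
      by (rule picard_sequences_diff_le[OF assms C(2) t])
    also have "\<dots> \<le> C * (M * (b - a)) ^ k / fact k"
      using t C(1) lipschitz_pos
      by (intro divide_right_mono mult_left_mono power_mono) auto
    finally show "norm (u k t - v k t) \<le> C * ((M * (b - a)) ^ k / fact k)"
      by simp
  qed
qed

section \<open>Convergence of the iterates, uniqueness and existence of the solution\<close>

lemma summable_picard_bound: "summable (\<lambda>k. C * ((M * (b - a)) ^ k / fact k))"
  using summable_mult[OF summable_exp[of "M * (b - a)"], of C] by (simp add: field_simps)

lemma picard_iterates_uniform_limit: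
  assumes y: "volterra_solution a b \<phi> K y" and y0: "continuous_on {a..b} y0"
  shows "uniform_limit {a..b} (picard_iterate a \<phi> K y0) y sequentially"
proof -
  obtain C where C: "\<And>k t. t \<in> {a..b} \<Longrightarrow>
      norm (picard_iterate a \<phi> K y0 k t - y t) \<le> C * ((M * (b - a)) ^ k / fact k)"
    by (rule picard_sequences_diff_le_uniform[of "picard_iterate a \<phi> K y0" "\<lambda>_. y"])
      (use y y0 continuous_on_picard_iterate in \<open>auto simp: volterra_solution_def\<close>)
  have lim: "(\<lambda>k. C * ((M * (b - a)) ^ k / fact k)) \<longlonglongrightarrow> 0"
    by (rule summable_LIMSEQ_zero[OF summable_picard_bound])
  show ?thesis
  proof (rule uniform_limitI)
    fix e :: real assume "0 < e"
    with lim have "\<forall>\<^sub>F k in sequentially. C * ((M * (b - a)) ^ k / fact k) < e"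
      by (rule order_tendstoD)
    then show "\<forall>\<^sub>F k in sequentially. \<forall>t\<in>{a..b}. dist (picard_iterate a \<phi> K y0 k t) (y t) < e"
    proof eventually_elim
      case (elim k)
      then show ?case
        using le_less_trans[OF C] by (simp add: dist_norm)
    qed
  qed
qed

text \<open>Two solutions are compared as constant sequences: their difference does not depend on
  \<open>k\<close>, while its bound tends to zero.\<close>

lemma volterra_solution_unique:
  assumes y: "volterra_solution a b \<phi> K y" and w: "volterra_solution a b \<phi> K w"
    and t: "t \<in> {a..b}"
  shows "w t = y t"
proof -
  obtain C where C: "\<And>k t. t \<in> {a..b} \<Longrightarrow> norm (w t - y t) \<le> C * ((M * (b - a)) ^ k / fact k)"
    by (rule picard_sequences_diff_le_uniform[of "\<lambda>_. w" "\<lambda>_. y"])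
      (use y w in \<open>auto simp: volterra_solution_def\<close>)
  have "norm (w t - y t) \<le> 0"
    by (rule LIMSEQ_le_const[OF summable_LIMSEQ_zero[OF summable_picard_bound]]) (use C t in blast)
  then show ?thesis by simp
qed

lemma volterra_solution_exists: "\<exists>y. volterra_solution a b \<phi> K y"
proof -
  define X where "X = picard_iterate a \<phi> K \<phi>"
  have X_Suc: "X (Suc k) t = picard_op a \<phi> K (X k) t" for k t
    by (simp add: X_def)
  have X_cont: "continuous_on {a..b} (X k)" for k
    unfolding X_def by (rule continuous_on_picard_iterate[OF forcing_continuous])
  obtain C where C: "\<And>k t. t \<in> {a..b} \<Longrightarrow>
      norm (X (Suc k) t - X k t) \<le> C * ((M * (b - a)) ^ k / fact k)"
    \<comment> \<open>The shifted sequence obeys the same recursion as \<open>X\<close>, so the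
      comparison bounds consecutive differences.\<close>
    using picard_sequences_diff_le_uniform[of "\<lambda>k. X (Suc k)" X, OF X_cont X_cont X_Suc X_Suc]
    by blast
  have telescope: "(\<Sum>k<n. X (Suc k) t - X k t) = X n t - X 0 t" for n t
    by (rule sum_lessThan_telescope)
  \<comment> \<open>The limit of \<open>X\<close> is written as a telescoping series so that the
    Weierstrass test can be applied.\<close>
  define y where "y t = X 0 t + (\<Sum>k. X (Suc k) t - X k t)" for t
  have "uniform_limit {a..b} (\<lambda>n t. \<Sum>k<n. X (Suc k) t - X k t)
      (\<lambda>t. \<Sum>k. X (Suc k) t - X k t) sequentially"
    using C summable_picard_bound by (rule Weierstrass_m_test)
  then have "uniform_limit {a..b} (\<lambda>n t. X 0 t + (\<Sum>k<n. X (Suc k) t - X k t)) y sequentially"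
    unfolding y_def by (intro uniform_limit_add uniform_limit_const)
  then have lim: "uniform_limit {a..b} X y sequentially"
    by (simp add: telescope)
  have y_cont: "continuous_on {a..b} y"
    by (rule uniform_limit_theorem[OF _ lim]) (use X_cont in auto)
  have "y t = picard_op a \<phi> K y t" if t: "t \<in> {a..b}" for t
  \<comment> \<open>The shifted iterates converge to \<open>y t\<close> by construction, and to the
    operator applied to \<open>y\<close> by the Lipschitz estimate.\<close>
  proof (rule LIMSEQ_unique)
    show "(\<lambda>k. X (Suc k) t) \<longlonglongrightarrow> y t"
      using tendsto_uniform_limitI[OF lim t] by (rule LIMSEQ_Suc)
    show "(\<lambda>k. X (Suc k) t) \<longlonglongrightarrow> picard_op a \<phi> K y t"
    proof (rule tendstoI)
      fix e :: real assume e: "0 < e"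
      \<comment> \<open>Uniform closeness \<open>d\<close> changes the operator by at most
        \<open>M * (t - a) * d\<close>. The added 1 keeps the denominator positive at
        \<open>t = a\<close> and makes the final inequality strict.\<close>
      define d where "d = e / (M * (t - a) + 1)"
      have pos: "0 < M * (t - a) + 1"
        using t lipschitz_pos by (simp add: add_nonneg_pos)
      then have "0 < d" using e by (simp add: d_def)
      have "M * ((t - a) * d) < (M * (t - a) + 1) * d"
        using \<open>0 < d\<close> by (simp add: algebra_simps)
      also have "\<dots> = e" using pos by (simp add: d_def)
      finally have less: "M * ((t - a) * d) < e" .
      from uniform_limitD[OF lim \<open>0 < d\<close>]
      show "\<forall>\<^sub>F k in sequentially. dist (X (Suc k) t) (picard_op a \<phi> K y t) < e"
      proof eventually_elim
        case (elim k)
        have "norm (picard_op a \<phi> K (X k) t - picard_op a \<phi> K y t) \<le> M * ((t - a) * d)"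
        proof (rule picard_op_diff_le[OF t X_cont y_cont])
          show "((\<lambda>_. d) has_integral (t - a) * d) {a..t}"
            using has_integral_const_real[of d a t] t by simp
          show "norm (X k s - y s) \<le> d" if "s \<in> {a..t}" for s
            using elim that t by (auto simp: dist_norm intro: less_imp_le)
        qed
        with less show ?case by (simp add: X_Suc dist_norm)
      qed
    qed
  qed
  with y_cont show ?thesis by (auto simp: volterra_solution_def)
qed

end

theorem theorem1p2:
  fixes a b :: real
    and \<phi> :: "real \<Rightarrow> real ^ 'n"
    and K :: "real \<Rightarrow> real \<Rightarrow> real ^ 'n \<Rightarrow> real ^ 'n"
  assumes "a \<le> b"
    and "continuous_on {a..b} \<phi>"
    and "continuous_on (volterra_domain a b \<times> UNIV) (\<lambda>((x, y), z). K x y z)"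
    and "\<exists>L::real. \<forall>(x, y)\<in>volterra_domain a b. \<forall>z z'.
           sum_norm (K x y z - K x y z') \<le> L * sum_norm (z - z')"
  shows "\<exists>y. volterra_solution a b \<phi> K y
           \<and> (\<forall>w. volterra_solution a b \<phi> K w \<longrightarrow> (\<forall>t\<in>{a..b}. w t = y t))
           \<and> (\<forall>y0. continuous_on {a..b} y0 \<longrightarrow>
                uniform_limit {a..b} (picard_iterate a \<phi> K y0) y sequentially)"
proof -
  from assms(4) obtain L where L: "\<And>x y z z'. (x, y) \<in> volterra_domain a b \<Longrightarrow>
      sum_norm (K x y z - K x y z') \<le> L * sum_norm (z - z')"
    by blast
  \<comment> \<open>The factor \<open>CARD('n)\<close> is the cost of passing from the sum norm to
    the Euclidean norm. Since \<open>L\<close> may be zero or negative,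
    \<open>\<bar>L\<bar> + 1\<close> is used to make \<open>M\<close> positive.\<close>
  define M where "M = (\<bar>L\<bar> + 1) * real CARD('n)"
  have lip: "norm (K x y z - K x y z') \<le> M * norm (z - z')"
    if "(x, y) \<in> volterra_domain a b" for x y z z'
  proof -
    have "norm (K x y z - K x y z') \<le> L * sum_norm (z - z')"
      using norm_le_sum_norm L[OF that] by (rule order_trans)
    also have "\<dots> \<le> (\<bar>L\<bar> + 1) * sum_norm (z - z')"
      by (intro mult_right_mono sum_norm_nonneg) simp
    also have "\<dots> \<le> (\<bar>L\<bar> + 1) * (real CARD('n) * norm (z - z'))"
      by (intro mult_left_mono sum_norm_le_card_norm) simp
    finally show ?thesis by (simp add: M_def mult.assoc)
  qed
  have "0 < M"
    by (simp add: M_def add_nonneg_pos)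
  with assms(1-3) lip interpret volterra_equation a b M \<phi> K
    by unfold_locales
  obtain y where "volterra_solution a b \<phi> K y"
    using volterra_solution_exists by blast
  then show ?thesis
    using volterra_solution_unique picard_iterates_uniform_limit by blast
qed

end
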